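(* Let $n\ge 1$ and let $(\xi_i,\mathcal{F}_i)_{i=0,\dots,n}$ be real-valued supermartingale differences with partial sums $S_k=\sum_{i=1}^k\xi_i$ and squared variation $[S]_k=\sum_{i=1}^k\xi_i^2$. Let $V_{i-1}$, $i\in[1,n]$, be non-negative $\mathcal{F}_{i-1}$-measurable random variables. Suppose that, for some $\lambda\in(0,\infty)$, for two non-negative functions $f(\lambda)$ and $g(\lambda)$, and for all $i\in[1,n]$, $$\mathbf{E}\left(\exp\{\lambda\xi_i-g(\lambda)\xi_i^2\}\,\middle|\,\mathcal{F}_{i-1}\right)\le 1+f(\lambda)V_{i-1}.$$ Then, for all $x,v,w>0$, $$\mathbf{P}\left(S_k\ge x,\ [S]_k\le v^2\ \text{and}\ \sum_{i=1}^kV_{i-1}\le w\ \text{for some}\ k\in[1,n]\right)\le \exp\left\{-\lambda x+g(\lambda)v^2+n\log\left(1+\frac{f(\lambda)}{n}w\right)\right\}\le \exp\left\{-\lambda x+g(\lambda)v^2+f(\lambda)w\right\}.$$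
   Context: $(\xi_i,\mathcal{F}_i)_{i=0,\dots,n}$ is a sequence of real-valued supermartingale differences on a probability space $(\Omega,\mathcal{F},\mathbf{P})$: $\xi_0=0$, $\{\emptyset,\Omega\}=\mathcal{F}_0\subseteq\dots\subseteq\mathcal{F}_n\subseteq\mathcal{F}$ are increasing $\sigma$-fields, $\xi_i$ is $\mathcal{F}_i$-measurable, and $\mathbf{E}(\xi_i|\mathcal{F}_{i-1})\le 0$ for $i=1,\dots,n$. Here $i,k\in[1,n]$ denote integers. Inequalities between conditional expectations hold almost surely. *)

theory Defs
  imports "HOL-Probability.Probability"
begin

text \<open>
  The filtration has finite horizon \<open>n\<close>: only \<open>F 0, \<dots>, F n\<close> are constrained. Integrability
  is part of the usual notion of a supermartingale difference. It has to be explicit here, because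
  \<^const>\<open>real_cond_exp\<close> is a total function whose value is meaningless when the
  conditional expectation does not exist.
\<close>

definition supermartingale_differences ::
    "'a measure \<Rightarrow> nat \<Rightarrow> (nat \<Rightarrow> 'a measure) \<Rightarrow> (nat \<Rightarrow> 'a \<Rightarrow> real) \<Rightarrow> bool" where
  "supermartingale_differences M n F \<xi> \<longleftrightarrow>
     (\<forall>i\<le>n. subalgebra M (F i)) \<and>
     (\<forall>i j. i \<le> j \<and> j \<le> n \<longrightarrow> subalgebra (F j) (F i)) \<and>
     sets (F 0) = {{}, space M} \<and>
     (\<forall>\<omega>\<in>space M. \<xi> 0 \<omega> = 0) \<and>
     (\<forall>i\<le>n. \<xi> i \<in> borel_measurable (F i)) \<and>
     (\<forall>i\<in>{1..n}. integrable M (\<xi> i)) \<and>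
     (\<forall>i\<in>{1..n}. AE \<omega> in M. real_cond_exp M (F (i - 1)) (\<xi> i) \<omega> \<le> 0)"

definition partial_sum :: "(nat \<Rightarrow> 'a \<Rightarrow> real) \<Rightarrow> nat \<Rightarrow> 'a \<Rightarrow> real" where
  "partial_sum \<xi> k \<omega> = (\<Sum>i=1..k. \<xi> i \<omega>)"

definition squared_variation :: "(nat \<Rightarrow> 'a \<Rightarrow> real) \<Rightarrow> nat \<Rightarrow> 'a \<Rightarrow> real" where
  "squared_variation \<xi> k \<omega> = (\<Sum>i=1..k. (\<xi> i \<omega>)\<^sup>2)"

end

theory Submission
  imports Defs
begin

text \<open>
  Normalising the exponentials by their conditional bounds, the process
  \<open>Z\<^sub>k = exp (\<Sum>i\<le>k. \<lambda> \<xi>\<^sub>i - g \<xi>\<^sub>i\<^sup>2 - ln (1 + f V\<^sub>i\<^sub>-\<^sub>1))\<close> is a non-negative supermartingale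
  with \<open>Z\<^sub>0 = 1\<close>. On the event in question some \<open>Z\<^sub>k\<close> is at least the reciprocal of the claimed
  bound, because concavity of \<open>ln\<close> gives \<open>\<Sum>i\<le>k. ln (1 + f V\<^sub>i\<^sub>-\<^sub>1) \<le> n ln (1 + f w / n)\<close> (missing
  terms count as \<open>ln 1\<close>). The maximal inequality for \<open>Z\<close> finishes the proof.
\<close>

text \<open>First-passage argument: paths are sorted by the first time at which \<open>Z\<close>
  reaches \<open>c\<close>. On paths that reach it, \<open>Z\<close> is then worth at least
  \<open>c\<close>; on the others the supermartingale property carries the integral back one step.
  That property is phrased with integrals over sets of \<open>F i\<close>, so no conditional
  expectation of \<open>Z\<close> has to be formed.\<close>

lemma supermartingale_maximal_inequality:
  fixes Z :: "nat \<Rightarrow> 'a \<Rightarrow> ennreal" and c :: ennreal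
  assumes sub: "\<And>i. i \<le> n \<Longrightarrow> subalgebra M (F i)"
    and mono: "\<And>i j. i \<le> j \<Longrightarrow> j \<le> n \<Longrightarrow> subalgebra (F j) (F i)"
    and meas: "\<And>i. i \<le> n \<Longrightarrow> Z i \<in> borel_measurable (F i)"
    and super: "\<And>i A. i < n \<Longrightarrow> A \<in> sets (F i) \<Longrightarrow>
                  (\<integral>\<^sup>+\<omega>\<in>A. Z (Suc i) \<omega> \<partial>M) \<le> (\<integral>\<^sup>+\<omega>\<in>A. Z i \<omega> \<partial>M)"
  shows "c * emeasure M {\<omega> \<in> space M. \<exists>k\<le>n. c \<le> Z k \<omega>} \<le> (\<integral>\<^sup>+\<omega>. Z 0 \<omega> \<partial>M)"
proof -
  \<comment> \<open>The event that level \<open>c\<close> has not been reached up to time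
    \<open>k\<close>. It is known at time \<open>k\<close>, so \<open>super\<close> can be applied
    on it.\<close>
  define N where "N k = {\<omega> \<in> space M. \<forall>j\<le>k. Z j \<omega> < c}" for k
  have N_F: "N k \<in> sets (F k)" if k: "k \<le> n" for k
  proof -
    have [measurable]: "Z j \<in> borel_measurable (F k)" if "j \<le> k" for j
      using measurable_from_subalg[OF mono meas] that k by auto
    have sp: "space (F k) = space M"
      using sub[OF k] by (simp add: subalgebra_def)
    have "N k = {\<omega> \<in> space (F k). \<forall>j\<in>{..k}. Z j \<omega> < c}"
      by (auto simp: N_def sp)
    also have "\<dots> \<in> sets (F k)"
      by (rule sets.sets_Collect_finite_All) auto
    finally show ?thesis .
  qed
  have N_M: "N k \<in> sets M" if "k \<le> n" for k
    using N_F[OF that] sub[OF that] by (auto simp: subalgebra_def)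
  have Z_M [measurable]: "Z k \<in> borel_measurable M" if "k \<le> n" for k
    using measurable_from_subalg[OF sub meas] that by auto
  have markov: "c * emeasure M A \<le> (\<integral>\<^sup>+\<omega>\<in>A. Z k \<omega> \<partial>M)"
    if "A \<in> sets M" "\<And>\<omega>. \<omega> \<in> A \<Longrightarrow> c \<le> Z k \<omega>" for A k
  proof -
    have "c * emeasure M A = (\<integral>\<^sup>+\<omega>\<in>A. c \<partial>M)"
      using that(1) by (simp add: nn_integral_cmult_indicator)
    also have "\<dots> \<le> (\<integral>\<^sup>+\<omega>\<in>A. Z k \<omega> \<partial>M)"
      using that(2) by (intro nn_integral_mono) (auto split: split_indicator)
    finally show ?thesis .
  qed
  have split: "(\<integral>\<^sup>+\<omega>\<in>B - A. Z k \<omega> \<partial>M) + (\<integral>\<^sup>+\<omega>\<in>A. Z k \<omega> \<partial>M) = (\<integral>\<^sup>+\<omega>\<in>B. Z k \<omega> \<partial>M)"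
    if "A \<in> sets M" "B \<in> sets M" "A \<subseteq> B" "k \<le> n" for A B k
  proof -
    have "(\<integral>\<^sup>+\<omega>\<in>B - A. Z k \<omega> \<partial>M) + (\<integral>\<^sup>+\<omega>\<in>A. Z k \<omega> \<partial>M)
        = (\<integral>\<^sup>+\<omega>. Z k \<omega> * indicator (B - A) \<omega> + Z k \<omega> * indicator A \<omega> \<partial>M)"
      using that by (intro nn_integral_add[symmetric]) auto
    also have "\<dots> = (\<integral>\<^sup>+\<omega>\<in>B. Z k \<omega> \<partial>M)"
      using that by (intro nn_integral_cong) (auto split: split_indicator)
    finally show ?thesis .
  qed
  \<comment> \<open>Invariant of the induction: the paths that have already hit are charged
    \<open>c\<close> each, the others still carry their current value \<open>Z k\<close>. Keeping
    this second summand is what lets the induction close.\<close>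
  have key: "c * emeasure M (space M - N k) + (\<integral>\<^sup>+\<omega>\<in>N k. Z k \<omega> \<partial>M) \<le> (\<integral>\<^sup>+\<omega>. Z 0 \<omega> \<partial>M)"
    if "k \<le> n" for k
    using that
  proof (induction k)
    case 0
    have "c * emeasure M (space M - N 0) \<le> (\<integral>\<^sup>+\<omega>\<in>space M - N 0. Z 0 \<omega> \<partial>M)"
      using N_M[OF 0] by (intro markov) (auto simp: N_def not_less)
    moreover have "(\<integral>\<^sup>+\<omega>\<in>space M - N 0. Z 0 \<omega> \<partial>M) + (\<integral>\<^sup>+\<omega>\<in>N 0. Z 0 \<omega> \<partial>M)
        = (\<integral>\<^sup>+\<omega>\<in>space M. Z 0 \<omega> \<partial>M)"
      using N_M[OF 0] by (intro split) (auto simp: N_def)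
    moreover have "(\<integral>\<^sup>+\<omega>\<in>space M. Z 0 \<omega> \<partial>M) = (\<integral>\<^sup>+\<omega>. Z 0 \<omega> \<partial>M)"
      by (intro nn_integral_cong) auto
    ultimately show ?case
      by (metis add_right_mono)
  next
    case (Suc k)
    then have k: "k \<le> n" "k < n" by auto
    note [measurable] = N_M[OF Suc.prems] N_M[OF k(1)]
    have sub_N: "N (Suc k) \<subseteq> N k" by (auto simp: N_def)
    \<comment> \<open>Such a path stayed below \<open>c\<close> up to time \<open>k\<close>, so it
      is the value at \<open>Suc k\<close> that reaches \<open>c\<close>.\<close>
    have hit: "c \<le> Z (Suc k) \<omega>" if "\<omega> \<in> N k - N (Suc k)" for \<omega>
      using that by (auto simp: N_def le_Suc_eq not_less)
    have "space M - N (Suc k) = (space M - N k) \<union> (N k - N (Suc k))"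
      using sub_N by (auto simp: N_def)
    then have "emeasure M (space M - N (Suc k))
        = emeasure M (space M - N k) + emeasure M (N k - N (Suc k))"
      by (subst plus_emeasure) auto
    then have "c * emeasure M (space M - N (Suc k)) + (\<integral>\<^sup>+\<omega>\<in>N (Suc k). Z (Suc k) \<omega> \<partial>M)
        = c * emeasure M (space M - N k)
          + (c * emeasure M (N k - N (Suc k)) + (\<integral>\<^sup>+\<omega>\<in>N (Suc k). Z (Suc k) \<omega> \<partial>M))"
      by (simp add: distrib_left add.assoc)
    also have "\<dots> \<le> c * emeasure M (space M - N k)
          + ((\<integral>\<^sup>+\<omega>\<in>N k - N (Suc k). Z (Suc k) \<omega> \<partial>M) + (\<integral>\<^sup>+\<omega>\<in>N (Suc k). Z (Suc k) \<omega> \<partial>M))"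
      by (intro add_mono order_refl markov hit) auto
    also have "\<dots> = c * emeasure M (space M - N k) + (\<integral>\<^sup>+\<omega>\<in>N k. Z (Suc k) \<omega> \<partial>M)"
      using sub_N Suc.prems by (subst split) auto
    also have "\<dots> \<le> c * emeasure M (space M - N k) + (\<integral>\<^sup>+\<omega>\<in>N k. Z k \<omega> \<partial>M)"
      by (intro add_mono order_refl super N_F k)
    also have "\<dots> \<le> (\<integral>\<^sup>+\<omega>. Z 0 \<omega> \<partial>M)"
      by (rule Suc.IH[OF k(1)])
    finally show ?case .
  qed
  have "{\<omega> \<in> space M. \<exists>k\<le>n. c \<le> Z k \<omega>} = space M - N n"
    by (auto simp: N_def not_less)
  then have "c * emeasure M {\<omega> \<in> space M. \<exists>k\<le>n. c \<le> Z k \<omega>}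
      \<le> c * emeasure M (space M - N n) + (\<integral>\<^sup>+\<omega>\<in>N n. Z n \<omega> \<partial>M)"
    by simp
  then show ?thesis
    using key[of n] by (simp add: order_trans)
qed

text \<open>An \<open>F\<close>-measurable weight can be moved through the conditional expectation,
  so \<open>e\<close> may be replaced by \<open>nn_cond_exp M F e\<close> under the integral, where
  the almost sure bound applies.\<close>

lemma (in sigma_finite_subalgebra) nn_integral_mult_le_of_nn_cond_exp_le:
  assumes [measurable]: "h \<in> borel_measurable F" "e \<in> borel_measurable M"
    and "AE \<omega> in M. nn_cond_exp M F e \<omega> \<le> b \<omega>"
  shows "(\<integral>\<^sup>+\<omega>. h \<omega> * e \<omega> \<partial>M) \<le> (\<integral>\<^sup>+\<omega>. h \<omega> * b \<omega> \<partial>M)"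
proof -
  have "(\<integral>\<^sup>+\<omega>. h \<omega> * e \<omega> \<partial>M) = (\<integral>\<^sup>+\<omega>. h \<omega> * nn_cond_exp M F e \<omega> \<partial>M)"
    by (rule nn_cond_exp_intg[symmetric]) auto
  also have "\<dots> \<le> (\<integral>\<^sup>+\<omega>. h \<omega> * b \<omega> \<partial>M)"
    by (rule nn_integral_mono_AE, rule eventually_mono[OF assms(3)]) (rule mult_left_mono, auto)
  finally show ?thesis .
qed

text \<open>Jensen's inequality for \<open>ln\<close>, proved by summing one tangent bound. This
  form copes directly with fewer than \<open>n\<close> terms and with a total below
  \<open>s\<close>.\<close>

lemma sum_ln_one_plus_le:
  fixes y :: "nat \<Rightarrow> real"
  assumes "k \<le> n" "1 \<le> n" and y: "\<And>i. i \<in> {1..k} \<Longrightarrow> 0 \<le> y i"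
    and "(\<Sum>i=1..k. y i) \<le> s" "0 \<le> s"
  shows "(\<Sum>i=1..k. ln (1 + y i)) \<le> real n * ln (1 + s / real n)"
proof -
  \<comment> \<open>The point of contact is the common value of \<open>1 + y i\<close> in the
    extremal case of \<open>n\<close> equal terms with total \<open>s\<close>.\<close>
  define a where "a = 1 + s / real n"
  have a: "1 \<le> a" using assms by (simp add: a_def)
  have an: "real n * a = real n + s" using assms(2) by (simp add: a_def field_simps)
  \<comment> \<open>the tangent to \<open>ln\<close> at \<open>a\<close>\<close>
  have tangent: "ln (1 + t) \<le> ln a + ((1 + t) / a - 1)" if "0 \<le> t" for t
  proof -
    have "ln ((1 + t) / a) \<le> (1 + t) / a - 1"
      using a that by (intro ln_le_minus_one) auto
    then show ?thesis
      using a that by (simp add: ln_div)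
  qed
  have "(\<Sum>i=1..k. ln (1 + y i)) \<le> (\<Sum>i=1..k. ln a + ((1 + y i) / a - 1))"
    using y by (intro sum_mono tangent) auto
  also have "\<dots> = real k * (ln a + (1 / a - 1)) + (\<Sum>i=1..k. y i) / a"
    by (simp add: sum.distrib sum_subtractf sum_divide_distrib[symmetric] add_divide_distrib
        algebra_simps)
  \<comment> \<open>Passing from \<open>k\<close> to \<open>n\<close> adds terms with
    \<open>y i = 0\<close>. Each contributes the tangent at \<open>t = 0\<close>, which is
    nonnegative because it lies above \<open>ln 1\<close>.\<close>
  also have "\<dots> \<le> real n * (ln a + (1 / a - 1)) + s / a"
  proof (intro add_mono mult_right_mono divide_right_mono)
    show "0 \<le> ln a + (1 / a - 1)" using tangent[of 0] by simp
  qed (use assms a in auto)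
  \<comment> \<open>With \<open>a\<close> chosen as above the numerator of the fraction vanishes,
    leaving only the logarithm.\<close>
  also have "\<dots> = real n * ln a + (real n + s - real n * a) / a"
    using a by (simp add: field_simps)
  finally show ?thesis using an by (simp add: a_def)
qed

theorem theorem2p1:
  fixes M :: "'a measure" and F :: "nat \<Rightarrow> 'a measure"
    and \<xi> V :: "nat \<Rightarrow> 'a \<Rightarrow> real" and n :: nat
    and f g :: "real \<Rightarrow> real" and l x v w :: real
  assumes "prob_space M"
    and "n \<ge> 1"
    and "supermartingale_differences M n F \<xi>"
    and "\<forall>i\<in>{1..n}. V (i - 1) \<in> borel_measurable (F (i - 1))"
    and "\<forall>i\<in>{1..n}. \<forall>\<omega>\<in>space M. 0 \<le> V (i - 1) \<omega>"
    and "\<forall>t>0. 0 \<le> f t"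
    and "\<forall>t>0. 0 \<le> g t"
    and "0 < l"
    and "\<forall>i\<in>{1..n}. AE \<omega> in M.
           nn_cond_exp M (F (i - 1)) (\<lambda>\<omega>'. ennreal (exp (l * \<xi> i \<omega>' - g l * (\<xi> i \<omega>')\<^sup>2))) \<omega>
             \<le> ennreal (1 + f l * V (i - 1) \<omega>)"
    and "0 < x" and "0 < v" and "0 < w"
  shows "measure M {\<omega> \<in> space M. \<exists>k\<in>{1..n}. partial_sum \<xi> k \<omega> \<ge> x \<and>
             squared_variation \<xi> k \<omega> \<le> v\<^sup>2 \<and> (\<Sum>i=1..k. V (i - 1) \<omega>) \<le> w}
           \<le> exp (- l * x + g l * v\<^sup>2 + real n * ln (1 + f l / real n * w))
         \<and> exp (- l * x + g l * v\<^sup>2 + real n * ln (1 + f l / real n * w))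
           \<le> exp (- l * x + g l * v\<^sup>2 + f l * w)"
proof
  interpret prob_space M by fact
  note V_meas = assms(4) and V_nonneg = assms(5) and cond = assms(9)
  have f: "0 \<le> f l" and g: "0 \<le> g l" using assms(6-8) by auto
  have sub: "\<And>i. i \<le> n \<Longrightarrow> subalgebra M (F i)"
    and mono: "\<And>i j. i \<le> j \<Longrightarrow> j \<le> n \<Longrightarrow> subalgebra (F j) (F i)"
    and \<xi>_meas: "\<And>i. i \<le> n \<Longrightarrow> \<xi> i \<in> borel_measurable (F i)"
    using assms(3) by (auto simp: supermartingale_differences_def)
  let ?B = "- l * x + g l * v\<^sup>2 + real n * ln (1 + f l / real n * w)"
  let ?E = "{\<omega> \<in> space M. \<exists>k\<in>{1..n}. partial_sum \<xi> k \<omega> \<ge> x \<and>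
             squared_variation \<xi> k \<omega> \<le> v\<^sup>2 \<and> (\<Sum>i=1..k. V (i - 1) \<omega>) \<le> w}"
  define X where "X i \<omega> = l * \<xi> i \<omega> - g l * (\<xi> i \<omega>)\<^sup>2" for i \<omega>
  define Z where "Z k \<omega> = exp (\<Sum>i=1..k. X i \<omega> - ln (1 + f l * V (i - 1) \<omega>))" for k \<omega>
  \<comment> \<open>The range of \<open>k\<close> includes 0 to match the maximal inequality;
    \<open>?H\<close> only has to contain \<open>?E\<close>.\<close>
  let ?H = "{\<omega> \<in> space M. \<exists>k\<le>n. ennreal (exp (- ?B)) \<le> ennreal (Z k \<omega>)}"
  have \<xi>_meas': "\<xi> i \<in> borel_measurable (F k)" if "i \<le> k" "k \<le> n" for i k
    using measurable_from_subalg[OF mono \<xi>_meas] that by auto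
  have V_meas': "V (i - 1) \<in> borel_measurable (F k)" if "i \<in> {1..n}" "i - 1 \<le> k" "k \<le> n" for i k
    using measurable_from_subalg[OF mono V_meas[rule_format]] that by auto
  have Z_meas: "Z k \<in> borel_measurable (F k)" if k: "k \<le> n" for k
    unfolding Z_def X_def
  proof (intro borel_measurable_exp[THEN measurable_compose_rev] borel_measurable_sum)
    fix i assume "i \<in> {1..k}"
    then have [measurable]: "\<xi> i \<in> borel_measurable (F k)" "V (i - 1) \<in> borel_measurable (F k)"
      using \<xi>_meas'[of i k] V_meas'[of i k] k by auto
    show "(\<lambda>\<omega>. l * \<xi> i \<omega> - g l * (\<xi> i \<omega>)\<^sup>2 - ln (1 + f l * V (i - 1) \<omega>)) \<in> borel_measurable (F k)"
      by measurable
  qed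
  have super: "(\<integral>\<^sup>+\<omega>\<in>A. ennreal (Z (Suc i) \<omega>) \<partial>M) \<le> (\<integral>\<^sup>+\<omega>\<in>A. ennreal (Z i \<omega>) \<partial>M)"
    if i: "i < n" and A [measurable]: "A \<in> sets (F i)" for i A
  proof -
    interpret Fi: finite_measure_subalgebra M "F i"
      using sub[of i] i by unfold_locales auto
    \<comment> \<open>The hypothesis on \<open>V\<close> is read at index \<open>Suc i\<close>,
      which lies in \<open>{1..n}\<close> since \<open>i < n\<close>. Positivity makes
      \<open>exp\<close> undo the \<open>ln\<close> in \<open>Z\<close>.\<close>
    have pos: "1 + f l * V i \<omega> > 0" if "\<omega> \<in> space M" for \<omega>
      using V_nonneg[rule_format, of "Suc i" \<omega>] f i that
      by (simp add: add_pos_nonneg)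
    have [measurable]: "Z i \<in> borel_measurable (F i)" "V i \<in> borel_measurable (F i)"
      using Z_meas[of i] V_meas'[of "Suc i" i] i by auto
    have [measurable]: "\<xi> (Suc i) \<in> borel_measurable M"
      using measurable_from_subalg[OF sub \<xi>_meas] i by auto
    \<comment> \<open>The part of the integrand known at time \<open>i\<close>: everything in
      \<open>Z (Suc i)\<close> on \<open>A\<close> except the factor \<open>exp (X (Suc i))\<close>,
      whose conditional expectation is bounded by \<open>cond\<close>.\<close>
    define h where "h \<omega> = indicator A \<omega> * ennreal (Z i \<omega> / (1 + f l * V i \<omega>))" for \<omega>
    have "(\<integral>\<^sup>+\<omega>\<in>A. ennreal (Z (Suc i) \<omega>) \<partial>M) = (\<integral>\<^sup>+\<omega>. h \<omega> * ennreal (exp (X (Suc i) \<omega>)) \<partial>M)"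
    proof (rule nn_integral_cong)
      fix \<omega> assume "\<omega> \<in> space M"
      then have "Z (Suc i) \<omega> = Z i \<omega> / (1 + f l * V i \<omega>) * exp (X (Suc i) \<omega>)"
        using pos[of \<omega>] by (simp add: Z_def exp_add exp_diff)
      then show "ennreal (Z (Suc i) \<omega>) * indicator A \<omega> = h \<omega> * ennreal (exp (X (Suc i) \<omega>))"
        using pos[OF \<open>\<omega> \<in> space M\<close>]
        by (simp only: h_def) (simp add: Z_def ennreal_mult'' split: split_indicator del: times_divide_eq_left)
    qed
    also have "\<dots> \<le> (\<integral>\<^sup>+\<omega>. h \<omega> * ennreal (1 + f l * V i \<omega>) \<partial>M)"
    proof (rule Fi.nn_integral_mult_le_of_nn_cond_exp_le)
      show "h \<in> borel_measurable (F i)" unfolding h_def by measurable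
      show "(\<lambda>\<omega>. ennreal (exp (X (Suc i) \<omega>))) \<in> borel_measurable M"
        unfolding X_def by measurable
      show "AE \<omega> in M. nn_cond_exp M (F i) (\<lambda>\<omega>. ennreal (exp (X (Suc i) \<omega>))) \<omega>
          \<le> ennreal (1 + f l * V i \<omega>)"
        using cond[rule_format, of "Suc i"] i by (simp add: X_def)
    qed
    \<comment> \<open>The conditional bound cancels the denominator of \<open>h\<close>, which is
      the purpose of the logarithmic correction in \<open>Z\<close>.\<close>
    also have "\<dots> = (\<integral>\<^sup>+\<omega>\<in>A. ennreal (Z i \<omega>) \<partial>M)"
    proof (rule nn_integral_cong)
      fix \<omega> assume "\<omega> \<in> space M"
      then show "h \<omega> * ennreal (1 + f l * V i \<omega>) = ennreal (Z i \<omega>) * indicator A \<omega>"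
        using pos[of \<omega>]
        by (auto simp: h_def Z_def ennreal_mult[symmetric] split: split_indicator)
    qed
    finally show ?thesis .
  qed
  have "ennreal (exp (- ?B)) * emeasure M ?H \<le> (\<integral>\<^sup>+\<omega>. ennreal (Z 0 \<omega>) \<partial>M)"
    by (rule supermartingale_maximal_inequality[where F = F])
      (use sub mono Z_meas super in auto)
  also have "\<dots> = ennreal 1"
    by (simp add: Z_def emeasure_space_1)
  finally have "exp (- ?B) * prob ?H \<le> 1"
    by (simp add: emeasure_eq_measure ennreal_mult[symmetric] flip: ennreal_1)
  then have prob_H: "prob ?H \<le> exp ?B"
    by (simp only: exp_minus) (simp add: field_simps)
  have "?E \<subseteq> ?H"
  proof
    fix \<omega> assume "\<omega> \<in> ?E"
    then obtain k where \<omega>: "\<omega> \<in> space M" and k: "k \<in> {1..n}"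
      and S: "x \<le> partial_sum \<xi> k \<omega>" and Q: "squared_variation \<xi> k \<omega> \<le> v\<^sup>2"
      and W: "(\<Sum>i=1..k. V (i - 1) \<omega>) \<le> w"
      by auto
    have "(\<Sum>i=1..k. f l * V (i - 1) \<omega>) \<le> f l * w"
      using W f by (simp add: sum_distrib_left[symmetric] mult_left_mono)
    \<comment> \<open>Here \<open>y i = f l * V (i - 1)\<close> and \<open>s = f l * w\<close>. The
      bound involves \<open>n\<close> instead of \<open>k\<close>, hence one threshold serves all
      times.\<close>
    then have "(\<Sum>i=1..k. ln (1 + f l * V (i - 1) \<omega>)) \<le> real n * ln (1 + f l * w / real n)"
      using k \<omega> f V_nonneg assms(2,12) by (intro sum_ln_one_plus_le) auto
    moreover have "(\<Sum>i=1..k. X i \<omega>) = l * partial_sum \<xi> k \<omega> - g l * squared_variation \<xi> k \<omega>"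
      by (simp add: X_def partial_sum_def squared_variation_def sum_subtractf sum_distrib_left)
    moreover have "l * x \<le> l * partial_sum \<xi> k \<omega>"
      using S assms(8) by simp
    moreover have "g l * squared_variation \<xi> k \<omega> \<le> g l * v\<^sup>2"
      using Q g by (rule mult_left_mono)
    ultimately have "- ?B \<le> (\<Sum>i=1..k. X i \<omega> - ln (1 + f l * V (i - 1) \<omega>))"
      by (simp add: sum_subtractf)
    then have "exp (- ?B) \<le> Z k \<omega>"
      unfolding Z_def by (simp only: exp_le_cancel_iff)
    then have "ennreal (exp (- ?B)) \<le> ennreal (Z k \<omega>)"
      by (rule ennreal_leI)
    then show "\<omega> \<in> ?H" using \<omega> k by auto
  qed
  \<comment> \<open>Measurability of the larger event is what monotonicity of the measure asks
    for.\<close>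
  moreover have "?H \<in> sets M"
  proof -
    have [measurable]: "Z k \<in> borel_measurable M" if "k \<le> n" for k
      using measurable_from_subalg[OF sub Z_meas] that by auto
    have "{\<omega> \<in> space M. \<exists>k\<in>{..n}. ennreal (exp (- ?B)) \<le> ennreal (Z k \<omega>)} \<in> sets M"
      by (rule sets.sets_Collect_finite_Ex) auto
    then show ?thesis by (simp add: Bex_def)
  qed
  ultimately have "prob ?E \<le> prob ?H"
    by (rule finite_measure_mono)
  then show "prob ?E \<le> exp ?B"
    using prob_H by linarith
  \<comment> \<open>The second bound is \<open>ln (1 + u) <= u\<close>, multiplied by
    \<open>n\<close>.\<close>
  have "ln (1 + f l / real n * w) \<le> f l / real n * w"
    using f assms(12) by (intro ln_add_one_self_le_self) auto
  then have "real n * ln (1 + f l / real n * w) \<le> real n * (f l / real n * w)"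
    by (intro mult_left_mono) auto
  then show "exp ?B \<le> exp (- l * x + g l * v\<^sup>2 + f l * w)"
    using assms(2) by simp
qed

end
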